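(* Let $m\ge2$, $d\ge1$ be integers, and let $\gamma$ be an arbitrary isomorphism of unital complex algebras from $C\ell^{\frac1m}_d$ onto ${\rm Mat}(m^{\frac d2},\mathbb{C})$ if $d$ is even, or onto the direct sum of $m$ copies of ${\rm Mat}(m^{\frac{d-1}2},\mathbb{C})$, regarded as block-diagonal matrices of size $m^{\frac{d+1}{2}}$, if $d$ is odd. Then $${\rm tr}(\gamma(U))=m^{[\frac{d+1}{2}]}\langle U\rangle_0,\qquad\forall\,U\in C\ell^{\frac1m}_d.$$
   Context: The generalized Clifford algebra $C\ell^{\frac1m}_d$ is the unital associative algebra over $\mathbb{C}$ with identity $e$ and generators $e_1,\dots,e_d$ subject to $e_j^m=e$ for $j=1,\dots,d$ and $e_ke_l=\omega e_le_k$ for $k<l$, where $\omega:=e^{2\pi i/m}$. It has dimension $m^d$ with basis $e_1^{j_1}\cdots e_d^{j_d}$, $0\le j_1,\dots,j_d\le m-1$, so each element is uniquely $U=\sum u_{j_1\ldots j_d}e_1^{j_1}\cdots e_d^{j_d}$ with $u_{j_1\ldots j_d}\in\mathbb{C}$. The projection onto grade $0$ is $\langle U\rangle_0:=u_{0\ldots0}e\equiv u_{0\ldots0}\in\mathbb{C}$. Here $[\cdot]$ denotes the integer part. *)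

theory Defs
  imports
    "HOL-Analysis.Analysis"
    "HOL-Algebra.QuotRing"
    "HOL-Algebra.Module"
    "Jordan_Normal_Form.Matrix"
begin

text \<open>
  Complex algebras are records of type \<^typ>\<open>(complex, 'b) module\<close>, which carry both a ring
  multiplication and a scalar action. The HOL-Algebra locale \<open>algebra\<close> is not used, since it
  requires commutativity.
\<close>

text \<open>
  The free unital associative algebra on the generators numbered \<open>1, \<dots>, d\<close>. A word is the list
  of its letters; an element is the finitely supported family of its word coefficients.
\<close>

definition free_alg :: "nat \<Rightarrow> (complex, nat list \<Rightarrow> complex) module" where
  "free_alg d = \<lparr>
     carrier = {f. finite {w. f w \<noteq> 0} \<and> (\<forall>w. f w \<noteq> 0 \<longrightarrow> set w \<subseteq> {1..d})},
     mult = (\<lambda>f g w. \<Sum>(u, v)\<in>{(u, v). u @ v = w}. f u * g v),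
     one = (\<lambda>w. if w = [] then 1 else 0),
     zero = (\<lambda>w. 0),
     add = (\<lambda>f g w. f w + g w),
     smult = (\<lambda>c f w. c * f w)\<rparr>"

definition free_gen :: "nat \<Rightarrow> nat list \<Rightarrow> complex" where
  "free_gen j = (\<lambda>w. if w = [j] then 1 else 0)"

definition omega :: "nat \<Rightarrow> complex" where
  "omega m = exp (2 * of_real pi * \<i> / of_nat m)"

definition gc_relators :: "nat \<Rightarrow> nat \<Rightarrow> (nat list \<Rightarrow> complex) set" where
  "gc_relators m d =
     (let F = free_alg d in
       {free_gen j [^]\<^bsub>F\<^esub> m \<ominus>\<^bsub>F\<^esub> \<one>\<^bsub>F\<^esub> | j. j \<in> {1..d}} \<union>
       {(free_gen k \<otimes>\<^bsub>F\<^esub> free_gen l) \<ominus>\<^bsub>F\<^esub> (omega m \<odot>\<^bsub>F\<^esub> (free_gen l \<otimes>\<^bsub>F\<^esub> free_gen k))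
         | k l. k \<in> {1..d} \<and> l \<in> {1..d} \<and> k < l})"

definition gc_ideal :: "nat \<Rightarrow> nat \<Rightarrow> (nat list \<Rightarrow> complex) set" where
  "gc_ideal m d = Idl\<^bsub>free_alg d\<^esub> (gc_relators m d)"

text \<open>
  The generalized Clifford algebra as the algebra presented by these generators and relations.
  The scalar action is \<open>c \<odot> (I + f) = I + c f\<close>; the ideal is added to the image because that
  image alone fails to be a coset when \<open>c = 0\<close>.
\<close>

definition gc_alg :: "nat \<Rightarrow> nat \<Rightarrow> (complex, (nat list \<Rightarrow> complex) set) module" where
  "gc_alg m d = ring.extend (free_alg d Quot gc_ideal m d)
     (module.fields
       (\<lambda>c X. gc_ideal m d <+>\<^bsub>free_alg d\<^esub> ((\<lambda>f. c \<odot>\<^bsub>free_alg d\<^esub> f) ` X)))"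

definition gc_gen :: "nat \<Rightarrow> nat \<Rightarrow> nat \<Rightarrow> (nat list \<Rightarrow> complex) set" where
  "gc_gen m d j = gc_ideal m d +>\<^bsub>free_alg d\<^esub> free_gen j"

definition gc_exponents :: "nat \<Rightarrow> nat \<Rightarrow> (nat \<Rightarrow> nat) set" where
  "gc_exponents m d = {1..d} \<rightarrow>\<^sub>E {0..m - 1}"

text \<open>The ordered product \<open>e\<^sub>1^(J 1) \<cdots> e\<^sub>d^(J d)\<close>.\<close>

definition gc_monomial :: "nat \<Rightarrow> nat \<Rightarrow> (nat \<Rightarrow> nat) \<Rightarrow> (nat list \<Rightarrow> complex) set" where
  "gc_monomial m d J =
     foldr (\<lambda>j X. gc_gen m d j [^]\<^bsub>gc_alg m d\<^esub> J j \<otimes>\<^bsub>gc_alg m d\<^esub> X) [1..<Suc d]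
       \<one>\<^bsub>gc_alg m d\<^esub>"

text \<open>
  The coefficient family of an element with respect to the monomial basis. Families are taken
  extensional on the exponent set, since otherwise they would not be unique.
\<close>

definition gc_coeffs ::
    "nat \<Rightarrow> nat \<Rightarrow> (nat list \<Rightarrow> complex) set \<Rightarrow> (nat \<Rightarrow> nat) \<Rightarrow> complex" where
  "gc_coeffs m d U =
     (THE u. u \<in> gc_exponents m d \<rightarrow>\<^sub>E UNIV \<and>
        U = (\<Oplus>\<^bsub>gc_alg m d\<^esub>J\<in>gc_exponents m d. u J \<odot>\<^bsub>gc_alg m d\<^esub> gc_monomial m d J))"

definition grade0 :: "nat \<Rightarrow> nat \<Rightarrow> (nat list \<Rightarrow> complex) set \<Rightarrow> complex" where
  "grade0 m d U = gc_coeffs m d U (\<lambda>j\<in>{1..d}. 0)"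

definition alg_iso ::
    "(complex, 'a) module \<Rightarrow> (complex, 'b) module \<Rightarrow> ('a \<Rightarrow> 'b) set" where
  "alg_iso A B =
     {h \<in> ring_iso A B. \<forall>c. \<forall>x\<in>carrier A. h (c \<odot>\<^bsub>A\<^esub> x) = c \<odot>\<^bsub>B\<^esub> h x}"

text \<open>The direct sum of \<open>k\<close> copies of the algebra of \<open>n \<times> n\<close> matrices, as block-diagonal matrices.\<close>

definition block_mat_alg :: "nat \<Rightarrow> nat \<Rightarrow> (complex, complex mat) module" where
  "block_mat_alg k n = (module_mat TYPE(complex) (k * n) (k * n))
     \<lparr>carrier := {diag_block_mat As | As. length As = k \<and> set As \<subseteq> carrier_mat n n}\<rparr>"

definition gc_mat_alg :: "nat \<Rightarrow> nat \<Rightarrow> (complex, complex mat) module" where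
  "gc_mat_alg m d =
     (if even d then module_mat TYPE(complex) (m ^ (d div 2)) (m ^ (d div 2))
      else block_mat_alg m (m ^ ((d - 1) div 2)))"

definition trace_mat :: "complex mat \<Rightarrow> complex" where
  "trace_mat A = (\<Sum>i<dim_row A. A $$ (i, i))"

end

theory Submission
  imports Defs "Jordan_Normal_Form.Determinant"
begin

text \<open>
  The trace of left multiplication by \<open>x\<close> on an algebra is invariant under isomorphism. On
  \<open>k\<close> copies of the \<open>n \<times> n\<close> matrices it equals \<open>n\<close> times the matrix trace, as the
  matrix units show. On the generalized Clifford algebra it is computed in the monomial basis:
  a nontrivial monomial permutes that basis without fixed points up to scalars, so the result is
  \<open>m ^ d\<close> times the grade-0 coefficient. Hence \<open>n tr(\<gamma>(U)) = m ^ d \<langle>U\<rangle>\<^sub>0\<close> with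
  \<open>n = m ^ (d div 2)\<close>. Linear independence of the monomials needs no separate construction:
  they span, and the isomorphism shows that the dimension is their number.
\<close>

section \<open>Monomials in quasi-commuting roots of unity\<close>

text \<open>Enumerating both index sets turns the families into square matrices of the same size,
  for which a one-sided inverse is two-sided. This takes the place of a dimension argument: spanning
  together with the right count will give independence.\<close>

lemma finite_square_left_inverse_imp_right_inverse:
  fixes P :: "'b \<Rightarrow> 'c \<Rightarrow> 'k::field" and Q :: "'c \<Rightarrow> 'b \<Rightarrow> 'k"
  assumes "finite B" "finite C" "card B = card C"
    and PQ: "\<And>b b'. b \<in> B \<Longrightarrow> b' \<in> B \<Longrightarrow> (\<Sum>c\<in>C. P b c * Q c b') = (if b = b' then 1 else 0)"
    and "c \<in> C" "c' \<in> C"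
  shows "(\<Sum>b\<in>B. Q c b * P b c') = (if c = c' then 1 else 0)"
proof -
  define n where "n = card B"
  obtain f where f: "bij_betw f {0..<n} B"
    using assms(1) ex_bij_betw_nat_finite n_def by blast
  obtain g where g: "bij_betw g {0..<n} C"
    using assms(2,3) ex_bij_betw_nat_finite n_def by metis
  define X where "X = mat n n (\<lambda>(i, j). P (f i) (g j))"
  define Y where "Y = mat n n (\<lambda>(i, j). Q (g i) (f j))"
  have X: "X \<in> carrier_mat n n" and Y: "Y \<in> carrier_mat n n"
    by (auto simp: X_def Y_def)
  have "X * Y = 1\<^sub>m n"
  proof (rule eq_matI)
    fix i j assume "i < dim_row (1\<^sub>m n)" "j < dim_col (1\<^sub>m n)"
    then have ij: "i < n" "j < n" by auto
    then have "(X * Y) $$ (i, j) = (\<Sum>k = 0..<n. P (f i) (g k) * Q (g k) (f j))"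
      by (simp add: X_def Y_def scalar_prod_def)
    also have "\<dots> = (\<Sum>c\<in>C. P (f i) c * Q c (f j))"
      by (rule sum.reindex_bij_betw[OF g])
    also have "\<dots> = (if f i = f j then 1 else 0)"
      using ij f by (intro PQ) (auto simp: bij_betw_def)
    also have "\<dots> = 1\<^sub>m n $$ (i, j)"
      using ij f by (auto simp: bij_betw_def inj_on_def)
    finally show "(X * Y) $$ (i, j) = 1\<^sub>m n $$ (i, j)" .
  qed (auto simp: X_def Y_def)
  then have YX: "Y * X = 1\<^sub>m n"
    using mat_mult_left_right_inverse X Y by blast
  obtain i j where ij: "i < n" "j < n" "c = g i" "c' = g j"
    using g assms(5,6) unfolding bij_betw_def by fastforce
  have "(\<Sum>b\<in>B. Q c b * P b c') = (\<Sum>k = 0..<n. Q c (f k) * P (f k) c')"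
    by (rule sum.reindex_bij_betw[OF f, symmetric])
  also have "\<dots> = (Y * X) $$ (i, j)"
    using ij by (simp add: X_def Y_def scalar_prod_def)
  also have "\<dots> = (if c = c' then 1 else 0)"
    using ij g by (auto simp: YX bij_betw_def inj_on_def)
  finally show ?thesis .
qed

section \<open>Algebras over a field, linear functionals and commutation up to scalars\<close>

locale unital_algebra = ring A for A :: "('k::field, 'a) module" (structure) +
  assumes smult_closed [simp]: "x \<in> carrier A \<Longrightarrow> c \<odot> x \<in> carrier A"
    and smult_l_distr: "x \<in> carrier A \<Longrightarrow> (b + c) \<odot> x = (b \<odot> x) \<oplus> (c \<odot> x)"
    and smult_r_distr: "\<lbrakk>x \<in> carrier A; y \<in> carrier A\<rbrakk> \<Longrightarrow> c \<odot> (x \<oplus> y) = (c \<odot> x) \<oplus> (c \<odot> y)"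
    and smult_smult: "x \<in> carrier A \<Longrightarrow> b \<odot> (c \<odot> x) = (b * c) \<odot> x"
    and smult_one [simp]: "x \<in> carrier A \<Longrightarrow> 1 \<odot> x = x"
    and smult_mult_left: "\<lbrakk>x \<in> carrier A; y \<in> carrier A\<rbrakk> \<Longrightarrow> (c \<odot> x) \<otimes> y = c \<odot> (x \<otimes> y)"
    and smult_mult_right: "\<lbrakk>x \<in> carrier A; y \<in> carrier A\<rbrakk> \<Longrightarrow> x \<otimes> (c \<odot> y) = c \<odot> (x \<otimes> y)"
begin

lemma smult_zero_left [simp]: "x \<in> carrier A \<Longrightarrow> 0 \<odot> x = \<zero>"
  using smult_l_distr[of x 0 0] smult_closed[of x 0] by simp

lemma smult_zero_right [simp]: "c \<odot> \<zero> = \<zero>"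
  using smult_smult[of \<zero> c 0] by simp

lemma smult_finsum:
  assumes "finite I" "f \<in> I \<rightarrow> carrier A"
  shows "c \<odot> (\<Oplus>i\<in>I. f i) = (\<Oplus>i\<in>I. c \<odot> f i)"
  using assms by (induct I) (auto simp: Pi_def smult_r_distr)

definition linear_functional :: "('a \<Rightarrow> 'k) \<Rightarrow> bool" where
  "linear_functional h \<longleftrightarrow>
     (\<forall>x\<in>carrier A. \<forall>y\<in>carrier A. h (x \<oplus> y) = h x + h y) \<and>
     (\<forall>c. \<forall>x\<in>carrier A. h (c \<odot> x) = c * h x)"

lemma linear_functional_finsum:
  assumes h: "linear_functional h" and "finite I" "f \<in> I \<rightarrow> carrier A"
  shows "h (\<Oplus>i\<in>I. f i) = (\<Sum>i\<in>I. h (f i))"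
proof -
  have "h \<zero> = 0"
    using h smult_zero_left[of \<zero>] unfolding linear_functional_def by (metis mult_zero_left zero_closed)
  with assms(2,3) h show ?thesis
    by (induct I) (auto simp: Pi_def linear_functional_def)
qed

lemma linear_functional_smult:
  "linear_functional h \<Longrightarrow> x \<in> carrier A \<Longrightarrow> h (c \<odot> x) = c * h x"
  by (simp add: linear_functional_def)

lemma linear_functional_lincomb:
  assumes "linear_functional h" "finite I" "f \<in> I \<rightarrow> carrier A"
  shows "h (\<Oplus>i\<in>I. u i \<odot> f i) = (\<Sum>i\<in>I. u i * h (f i))"
  using assms by (subst linear_functional_finsum) (auto simp: Pi_def linear_functional_smult)

text \<open>The trace computation only asks which monomial a product is proportional to, so the
  factor, in the application a power of \<open>omega m\<close>, stays hidden behind an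
  existential.\<close>

definition scalar_commute :: "'a \<Rightarrow> 'a \<Rightarrow> bool" where
  "scalar_commute x y \<longleftrightarrow> (\<exists>c. x \<otimes> y = c \<odot> (y \<otimes> x))"

lemma scalar_commute_one_left [simp]: "x \<in> carrier A \<Longrightarrow> scalar_commute \<one> x"
  unfolding scalar_commute_def by (rule exI[of _ 1]) simp

lemma scalar_commute_one_right [simp]: "x \<in> carrier A \<Longrightarrow> scalar_commute x \<one>"
  unfolding scalar_commute_def by (rule exI[of _ 1]) simp

lemma scalar_commute_mult_left:
  assumes "x \<in> carrier A" "y \<in> carrier A" "z \<in> carrier A"
    and "scalar_commute x z" "scalar_commute y z"
  shows "scalar_commute (x \<otimes> y) z"
proof -
  obtain a b where ab: "x \<otimes> z = a \<odot> (z \<otimes> x)" "y \<otimes> z = b \<odot> (z \<otimes> y)"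
    using assms unfolding scalar_commute_def by auto
  have "(x \<otimes> y) \<otimes> z = x \<otimes> (b \<odot> (z \<otimes> y))"
    using assms ab by (simp add: m_assoc)
  also have "\<dots> = b \<odot> ((x \<otimes> z) \<otimes> y)"
    using assms by (simp add: m_assoc smult_mult_right)
  also have "\<dots> = (b * a) \<odot> (z \<otimes> (x \<otimes> y))"
    using assms ab by (simp add: m_assoc smult_mult_left smult_smult)
  finally show ?thesis unfolding scalar_commute_def by blast
qed

lemma scalar_commute_mult_right:
  assumes "x \<in> carrier A" "y \<in> carrier A" "z \<in> carrier A"
    and "scalar_commute z x" "scalar_commute z y"
  shows "scalar_commute z (x \<otimes> y)"
proof -
  obtain a b where ab: "z \<otimes> x = a \<odot> (x \<otimes> z)" "z \<otimes> y = b \<odot> (y \<otimes> z)"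
    using assms unfolding scalar_commute_def by auto
  have "z \<otimes> (x \<otimes> y) = (a \<odot> (x \<otimes> z)) \<otimes> y"
    using assms ab by (simp flip: m_assoc)
  also have "\<dots> = a \<odot> (x \<otimes> (z \<otimes> y))"
    using assms by (simp add: m_assoc smult_mult_left)
  also have "\<dots> = (a * b) \<odot> ((x \<otimes> y) \<otimes> z)"
    using assms ab by (simp add: m_assoc smult_mult_right smult_smult)
  finally show ?thesis unfolding scalar_commute_def by blast
qed

lemma scalar_commute_pow_left:
  "\<lbrakk>x \<in> carrier A; y \<in> carrier A; scalar_commute x y\<rbrakk> \<Longrightarrow> scalar_commute (x [^] (n::nat)) y"
  by (induct n) (auto intro: scalar_commute_mult_left)

lemma scalar_commute_pow_right:
  "\<lbrakk>x \<in> carrier A; y \<in> carrier A; scalar_commute y x\<rbrakk> \<Longrightarrow> scalar_commute y (x [^] (n::nat))"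
  by (induct n) (auto intro: scalar_commute_mult_right)

end

section \<open>Monomials and their products\<close>

locale quasi_commuting_roots = unital_algebra A
  for A :: "('k::field, 'a) module" (structure) +
  fixes m d :: nat and g :: "nat \<Rightarrow> 'a"
  assumes m_ge_2: "m \<ge> 2"
    and gen_closed: "j \<in> {1..d} \<Longrightarrow> g j \<in> carrier A"
    and gen_pow: "j \<in> {1..d} \<Longrightarrow> g j [^] m = \<one>"
    and gen_commute: "\<lbrakk>k \<in> {1..d}; l \<in> {1..d}; k < l\<rbrakk> \<Longrightarrow> scalar_commute (g l) (g k)"
begin

text \<open>The list is a parameter so that inductions can split off the first generator; the list
  \<open>[1..<Suc d]\<close> gives the monomials of \<open>gc_monomial\<close>.\<close>

definition monomial_on :: "nat list \<Rightarrow> (nat \<Rightarrow> nat) \<Rightarrow> 'a" where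
  "monomial_on js J = foldr (\<lambda>j X. g j [^] J j \<otimes> X) js \<one>"

lemma monomial_on_simps [simp]:
  "monomial_on [] J = \<one>"
  "monomial_on (j # js) J = g j [^] J j \<otimes> monomial_on js J"
  by (simp_all add: monomial_on_def)

lemma monomial_on_closed [simp]: "set js \<subseteq> {1..d} \<Longrightarrow> monomial_on js J \<in> carrier A"
  by (induct js) (auto simp: gen_closed)

lemma monomial_on_cong: "(\<And>j. j \<in> set js \<Longrightarrow> J j = K j) \<Longrightarrow> monomial_on js J = monomial_on js K"
  by (induct js) auto

lemma monomial_on_eq_one: "set js \<subseteq> {1..d} \<Longrightarrow> (\<And>j. j \<in> set js \<Longrightarrow> J j = 0) \<Longrightarrow> monomial_on js J = \<one>"
  by (induct js) auto

lemma gen_pow_mod: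
  assumes "j \<in> {1..d}"
  shows "g j [^] (n mod m) = g j [^] n"
proof -
  have "g j [^] n = g j [^] (m * (n div m) + n mod m)" by simp
  also have "\<dots> = (g j [^] m) [^] (n div m) \<otimes> g j [^] (n mod m)"
    using gen_closed[OF assms] by (simp add: nat_pow_pow nat_pow_mult)
  also have "\<dots> = g j [^] (n mod m)"
    using gen_closed[OF assms] by (simp add: gen_pow[OF assms])
  finally show ?thesis by simp
qed

text \<open>All indices in \<open>js\<close> exceed \<open>k\<close>, so each factor passes
  \<open>g k\<close> by \<open>gen_commute\<close> at the cost of a scalar. This is what sorts a
  product into ascending order.\<close>

lemma monomial_on_commute:
  "\<lbrakk>set js \<subseteq> {1..d}; k \<in> {1..d}; \<And>l. l \<in> set js \<Longrightarrow> k < l\<rbrakk>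
    \<Longrightarrow> scalar_commute (monomial_on js J) (g k [^] (n::nat))"
  by (induct js)
    (auto intro!: scalar_commute_mult_left scalar_commute_pow_left gen_commute
      intro: scalar_commute_pow_right simp: gen_closed)

text \<open>Strict ascent lets the first generator of the right factor move left across the tail of
  the left factor. Equal generators then merge, \<open>gen_pow\<close> reduces the exponent mod
  \<open>m\<close>, and the tails are left to the induction.\<close>

lemma monomial_on_mult:
  "\<lbrakk>set js \<subseteq> {1..d}; sorted_wrt (<) js\<rbrakk>
    \<Longrightarrow> \<exists>c. monomial_on js K \<otimes> monomial_on js J = c \<odot> monomial_on js (\<lambda>j. (K j + J j) mod m)"
proof (induct js)
  case Nil
  show ?case by (rule exI[of _ 1]) simp
next
  case (Cons j js)
  let ?X = "monomial_on js K" and ?Y = "monomial_on js J"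
  have j: "j \<in> {1..d}" and js: "set js \<subseteq> {1..d}" using Cons.prems by auto
  note [simp] = gen_closed[OF j] monomial_on_closed[OF js]
  obtain c where c: "?X \<otimes> ?Y = c \<odot> monomial_on js (\<lambda>j. (K j + J j) mod m)"
    using Cons by auto
  obtain b where b: "?X \<otimes> g j [^] J j = b \<odot> (g j [^] J j \<otimes> ?X)"
    using monomial_on_commute[OF js j, of K "J j"] Cons.prems unfolding scalar_commute_def by auto
  have "monomial_on (j # js) K \<otimes> monomial_on (j # js) J
      = g j [^] K j \<otimes> ((?X \<otimes> g j [^] J j) \<otimes> ?Y)"
    by (simp add: m_assoc)
  also have "\<dots> = b \<odot> ((g j [^] K j \<otimes> g j [^] J j) \<otimes> (?X \<otimes> ?Y))"
    by (simp add: b smult_mult_left smult_mult_right m_assoc)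
  also have "\<dots> = (b * c) \<odot> monomial_on (j # js) (\<lambda>j. (K j + J j) mod m)"
    by (simp add: c smult_mult_right smult_smult nat_pow_mult gen_pow_mod[OF j])
  finally show ?case by blast
qed

definition monomial :: "(nat \<Rightarrow> nat) \<Rightarrow> 'a" where
  "monomial = monomial_on [1..<Suc d]"

lemma monomial_closed [simp]: "monomial J \<in> carrier A"
  unfolding monomial_def by (rule monomial_on_closed) auto

text \<open>This is the group law of (Z/m)^d on representatives; the monomials multiply along it up
  to scalars.\<close>

definition mod_add :: "(nat \<Rightarrow> nat) \<Rightarrow> (nat \<Rightarrow> nat) \<Rightarrow> nat \<Rightarrow> nat" where
  "mod_add K J = (\<lambda>j\<in>{1..d}. (K j + J j) mod m)"

lemma mod_add_exponents [simp]: "mod_add K J \<in> gc_exponents m d"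
  using m_ge_2 unfolding mod_add_def gc_exponents_def
  by (auto intro!: restrict_PiE simp: less_Suc_eq_le[symmetric])

lemma monomial_mult: "\<exists>c. monomial K \<otimes> monomial J = c \<odot> monomial (mod_add K J)"
proof -
  have "monomial (mod_add K J) = monomial (\<lambda>j. (K j + J j) mod m)"
    unfolding monomial_def by (rule monomial_on_cong) (auto simp: mod_add_def)
  moreover have "set [1..<Suc d] \<subseteq> {1..d}" by auto
  ultimately show ?thesis
    using monomial_on_mult[of "[1..<Suc d]" K J] by (simp only: monomial_def sorted_wrt_upt)
qed

lemma monomial_zero: "monomial (\<lambda>j\<in>{1..d}. 0) = \<one>"
  unfolding monomial_def by (rule monomial_on_eq_one) auto

lemma zero_exponents [simp]: "(\<lambda>j\<in>{1..d}. 0) \<in> gc_exponents m d"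
  by (auto simp: gc_exponents_def)

text \<open>A translation of (Z/m)^d with a fixed point is trivial. Hence a nontrivial monomial
  moves every basis monomial to a multiple of a different one.\<close>

lemma mod_add_fixed:
  assumes "K \<in> gc_exponents m d" "J \<in> gc_exponents m d" "mod_add K J = J"
  shows "K = (\<lambda>j\<in>{1..d}. 0)"
proof (rule extensionalityI)
  show "K \<in> extensional {1..d}" using assms by (auto simp: gc_exponents_def PiE_def)
  fix j assume j: "j \<in> {1..d}"
  then have "(K j + J j) mod m = J j"
    using fun_cong[OF assms(3), of j] by (simp add: mod_add_def)
  moreover have "K j < m" "J j < m"
    using assms j m_ge_2 PiE_mem[of _ "{1..d}" "\<lambda>_. {0..m - 1}" j]
    by (auto simp: gc_exponents_def less_Suc_eq_le[symmetric])
  \<comment> \<open>The sum is below \<open>2 * m\<close>: without wrap-around the equation gives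
    \<open>K j = 0\<close>, with wrap-around it would give \<open>K j = m\<close>.\<close>
  ultimately have "K j = 0"
    by (cases "K j + J j < m") (auto simp: le_mod_geq)
  then show "K j = (\<lambda>j\<in>{1..d}. 0) j" using j by simp
qed simp

lemma finite_exponents [simp]: "finite (gc_exponents m d)"
  by (auto simp: gc_exponents_def intro: finite_PiE)

lemma card_exponents: "card (gc_exponents m d) = m ^ d"
  using m_ge_2 by (simp add: gc_exponents_def card_PiE)

section \<open>The span of the monomials\<close>

definition monomial_span :: "'a set" where
  "monomial_span = {\<Oplus>J\<in>gc_exponents m d. u J \<odot> monomial J | u. True}"

lemma monomial_span_closed: "x \<in> monomial_span \<Longrightarrow> x \<in> carrier A"
  by (auto simp: monomial_span_def intro!: finsum_closed)

lemma monomial_span_add: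
  assumes "x \<in> monomial_span" "y \<in> monomial_span"
  shows "x \<oplus> y \<in> monomial_span"
proof -
  obtain u v where "x = (\<Oplus>J\<in>gc_exponents m d. u J \<odot> monomial J)"
    "y = (\<Oplus>J\<in>gc_exponents m d. v J \<odot> monomial J)"
    using assms by (auto simp: monomial_span_def)
  then have "x \<oplus> y = (\<Oplus>J\<in>gc_exponents m d. (u J + v J) \<odot> monomial J)"
    by (simp add: smult_l_distr finsum_addf)
  then show ?thesis unfolding monomial_span_def by (auto intro!: exI[of _ "\<lambda>J. u J + v J"])
qed

lemma monomial_span_smult:
  assumes "x \<in> monomial_span"
  shows "c \<odot> x \<in> monomial_span"
proof -
  obtain u where "x = (\<Oplus>J\<in>gc_exponents m d. u J \<odot> monomial J)"
    using assms by (auto simp: monomial_span_def)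
  then have "c \<odot> x = (\<Oplus>J\<in>gc_exponents m d. (c * u J) \<odot> monomial J)"
    by (simp add: smult_finsum smult_smult)
  then show ?thesis unfolding monomial_span_def by (auto intro!: exI[of _ "\<lambda>J. c * u J"])
qed

lemma monomial_in_span:
  assumes "K \<in> gc_exponents m d"
  shows "monomial K \<in> monomial_span"
proof -
  have "(\<Oplus>J\<in>gc_exponents m d. (if J = K then 1 else 0) \<odot> monomial J)
     = (\<Oplus>J\<in>gc_exponents m d. if K = J then monomial J else \<zero>)"
    by (rule finsum_cong) (auto simp: simp_implies_def)
  also have "\<dots> = monomial K"
    using assms by (intro finsum_singleton) auto
  finally show ?thesis unfolding monomial_span_def by (auto intro!: exI[of _ "\<lambda>J. if J = K then 1 else 0"])
qed

lemma monomial_span_zero: "\<zero> \<in> monomial_span"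
  using monomial_span_smult[OF monomial_in_span[OF zero_exponents], of 0] by simp

lemma monomial_span_one: "\<one> \<in> monomial_span"
  using monomial_in_span[OF zero_exponents] by (simp only: monomial_zero)

lemma monomial_span_finsum:
  assumes "finite I" "\<And>i. i \<in> I \<Longrightarrow> f i \<in> monomial_span"
  shows "(\<Oplus>i\<in>I. f i) \<in> monomial_span"
  using assms
proof (induct I)
  case (insert i I)
  then have "(\<Oplus>i\<in>insert i I. f i) = f i \<oplus> (\<Oplus>i\<in>I. f i)"
    by (intro finsum_insert) (auto intro: monomial_span_closed)
  then show ?case using insert by (auto intro: monomial_span_add)
qed (simp add: monomial_span_zero)

lemma gen_eq_monomial:
  assumes "k \<in> {1..d}"
  shows "monomial (\<lambda>j. if j = k then 1 else 0) = g k"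
proof -
  \<comment> \<open>Generalised to lists for the induction; distinctness ensures that
    \<open>g k\<close> occurs at most once.\<close>
  have "monomial_on js (\<lambda>j. if j = k then 1 else 0) = (if k \<in> set js then g k else \<one>)"
    if "set js \<subseteq> {1..d}" "distinct js" for js
    using that gen_closed[OF assms] by (induct js) (auto simp: gen_closed)
  moreover have "set [1..<Suc d] \<subseteq> {1..d}" "k \<in> set [1..<Suc d]" using assms by auto
  ultimately show ?thesis by (simp only: monomial_def distinct_upt if_True)
qed

text \<open>Prefixing a letter only shifts the exponents and scales, by
  \<open>monomial_mult\<close>. Starting from \<open>monomial_span_one\<close>, this reaches every
  word in the generators.\<close>

lemma monomial_span_gen_mult:
  assumes k: "k \<in> {1..d}" and x: "x \<in> monomial_span"
  shows "g k \<otimes> x \<in> monomial_span"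
proof -
  obtain u where u: "x = (\<Oplus>J\<in>gc_exponents m d. u J \<odot> monomial J)"
    using x by (auto simp: monomial_span_def)
  have "g k \<otimes> x = (\<Oplus>J\<in>gc_exponents m d. u J \<odot> (g k \<otimes> monomial J))"
    by (simp add: u finsum_rdistr gen_closed[OF k] smult_mult_right)
  moreover have "g k \<otimes> monomial J \<in> monomial_span" for J
    using monomial_mult[of "\<lambda>j. if j = k then 1 else 0" J]
    unfolding gen_eq_monomial[OF k] by (metis monomial_span_smult monomial_in_span mod_add_exponents)
  ultimately show ?thesis
    by (auto intro!: monomial_span_finsum monomial_span_smult)
qed

section \<open>Dual families and the trace of left multiplication\<close>

text \<open>
  \<open>h\<close> and \<open>y\<close> are a dual pair of families, so \<open>\<Sum>b\<in>B. h b (x \<otimes> y b)\<close> is the trace of left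
  multiplication by \<open>x\<close>; it is evaluated on the monomial basis, which multiplication by a
  nontrivial monomial permutes without fixed points up to scalars.
\<close>

context
  fixes B :: "'b set" and h :: "'b \<Rightarrow> 'a \<Rightarrow> 'k" and y :: "'b \<Rightarrow> 'a"
  assumes span: "carrier A \<subseteq> monomial_span"
    and finB: "finite B" and cardB: "card B = m ^ d"
    and h: "b \<in> B \<Longrightarrow> linear_functional (h b)"
    and y: "b \<in> B \<Longrightarrow> y b \<in> carrier A"
    and hy: "\<lbrakk>b \<in> B; b' \<in> B\<rbrakk> \<Longrightarrow> h b (y b') = (if b = b' then 1 else 0)"
begin

text \<open>The numbers \<open>h b (monomial J)\<close> and \<open>Q J b\<close> form matrices P and
  Q, and duality of \<open>h\<close> and \<open>y\<close> says P Q = 1. They are square because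
  \<open>card B\<close> is the number of exponents, so Q P = 1 as well. Thus the row of Q at
  \<open>K\<close> combines the functionals \<open>h b\<close> into the one that reads off the
  coefficient at \<open>K\<close>.\<close>

lemma dual_basis_coefficients:
  obtains Q where
    "\<And>b. b \<in> B \<Longrightarrow> y b = (\<Oplus>J\<in>gc_exponents m d. Q J b \<odot> monomial J)"
    "\<And>u K. K \<in> gc_exponents m d \<Longrightarrow>
       (\<Sum>b\<in>B. Q K b * h b (\<Oplus>J\<in>gc_exponents m d. u J \<odot> monomial J)) = u K"
proof -
  have "\<forall>b\<in>B. \<exists>u. y b = (\<Oplus>J\<in>gc_exponents m d. u J \<odot> monomial J)"
  proof
    fix b assume "b \<in> B"
    then have "y b \<in> monomial_span" using span y by blast
    then show "\<exists>u. y b = (\<Oplus>J\<in>gc_exponents m d. u J \<odot> monomial J)"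
      unfolding monomial_span_def by blast
  qed
  then obtain Q' where Q': "\<forall>b\<in>B. y b = (\<Oplus>J\<in>gc_exponents m d. Q' b J \<odot> monomial J)"
    by (rule bchoice[THEN exE])
  define Q where "Q J b = Q' b J" for J b
  have Q: "y b = (\<Oplus>J\<in>gc_exponents m d. Q J b \<odot> monomial J)" if "b \<in> B" for b
    using Q' that by (simp add: Q_def)
  have hlin: "h b (\<Oplus>J\<in>gc_exponents m d. u J \<odot> monomial J)
      = (\<Sum>J\<in>gc_exponents m d. u J * h b (monomial J))" if "b \<in> B" for b u
    using that by (intro linear_functional_lincomb h) auto
  have inv: "(\<Sum>b\<in>B. Q K b * h b (monomial J)) = (if K = J then 1 else 0)"
    if "K \<in> gc_exponents m d" "J \<in> gc_exponents m d" for K J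
  proof (rule finite_square_left_inverse_imp_right_inverse[OF finB finite_exponents _ _ that])
    show "card B = card (gc_exponents m d)" by (simp add: cardB card_exponents)
    fix b b' assume "b \<in> B" "b' \<in> B"
    then show "(\<Sum>J\<in>gc_exponents m d. h b (monomial J) * Q J b') = (if b = b' then 1 else 0)"
      using hy[of b b'] hlin[of b "\<lambda>J. Q J b'"] Q[of b'] by (simp add: mult.commute)
  qed
  have "(\<Sum>b\<in>B. Q K b * h b (\<Oplus>J\<in>gc_exponents m d. u J \<odot> monomial J)) = u K"
    if K: "K \<in> gc_exponents m d" for u K
  proof -
    have "(\<Sum>b\<in>B. Q K b * h b (\<Oplus>J\<in>gc_exponents m d. u J \<odot> monomial J))
       = (\<Sum>b\<in>B. \<Sum>J\<in>gc_exponents m d. u J * (Q K b * h b (monomial J)))"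
      by (rule sum.cong) (auto simp: hlin sum_distrib_left mult_ac)
    also have "\<dots> = (\<Sum>J\<in>gc_exponents m d. u J * (\<Sum>b\<in>B. Q K b * h b (monomial J)))"
      by (subst sum.swap) (simp add: sum_distrib_left)
    also have "\<dots> = (\<Sum>J\<in>gc_exponents m d. if K = J then u J else 0)"
      using K by (intro sum.cong) (auto simp: inv)
    also have "\<dots> = u K" using K by simp
    finally show ?thesis .
  qed
  with Q that show ?thesis by blast
qed

text \<open>The functionals of \<open>dual_basis_coefficients\<close> see only the element, not the
  combination chosen to write it. This is the linear independence of the monomials.\<close>

lemma monomial_coefficients_unique:
  assumes "(\<Oplus>J\<in>gc_exponents m d. u J \<odot> monomial J) = (\<Oplus>J\<in>gc_exponents m d. v J \<odot> monomial J)"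
    and "K \<in> gc_exponents m d"
  shows "u K = v K"
proof -
  obtain Q where
    "\<And>u K. K \<in> gc_exponents m d \<Longrightarrow>
       (\<Sum>b\<in>B. Q K b * h b (\<Oplus>J\<in>gc_exponents m d. u J \<odot> monomial J)) = u K"
    by (rule dual_basis_coefficients) blast
  from this[of K u] this[of K v] assms show ?thesis by simp
qed

text \<open>Expanding each \<open>y b\<close> through \<open>Q\<close> is a change of basis, so the
  sum becomes one of diagonal coefficients in the monomial basis, where only the identity
  contributes.\<close>

lemma trace_left_mult:
  "(\<Sum>b\<in>B. h b ((\<Oplus>J\<in>gc_exponents m d. u J \<odot> monomial J) \<otimes> y b))
     = of_nat (m ^ d) * u (\<lambda>j\<in>{1..d}. 0)"
proof -
  let ?E = "gc_exponents m d" and ?z = "\<lambda>j\<in>{1..d}. 0::nat"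
  obtain Q where Q: "\<And>b. b \<in> B \<Longrightarrow> y b = (\<Oplus>J\<in>?E. Q J b \<odot> monomial J)"
    and dual: "\<And>u K. K \<in> ?E \<Longrightarrow> (\<Sum>b\<in>B. Q K b * h b (\<Oplus>J\<in>?E. u J \<odot> monomial J)) = u K"
    by (rule dual_basis_coefficients) blast
  have dual_monomial: "(\<Sum>b\<in>B. Q K b * h b (c \<odot> monomial L)) = (if K = L then c else 0)"
    if "K \<in> ?E" "L \<in> ?E" for K L c
  proof -
    \<comment> \<open>A single term is written as a full combination with all other coefficients
      zero, so that \<open>dual\<close> applies.\<close>
    have "(\<Oplus>J\<in>?E. (if J = L then c else 0) \<odot> monomial J) = (\<Oplus>J\<in>?E. if L = J then c \<odot> monomial J else \<zero>)"
      by (rule finsum_cong) (auto simp: simp_implies_def)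
    also have "\<dots> = c \<odot> monomial L"
      using that by (intro finsum_singleton) auto
    finally show ?thesis
      using dual[OF that(1), of "\<lambda>J. if J = L then c else 0"] by simp
  qed
  have diag: "(\<Sum>b\<in>B. Q J b * h b (monomial K \<otimes> monomial J)) = (if K = ?z then 1 else 0)"
    if K: "K \<in> ?E" and J: "J \<in> ?E" for K J
  proof (cases "K = ?z")
    case True
    then have "monomial K = \<one>" using monomial_zero by simp
    then show ?thesis using dual_monomial[OF J J, of 1] True by simp
  next
    case False
    \<comment> \<open>By \<open>mod_add_fixed\<close> the product sits at an exponent other than
      \<open>J\<close>, so its coefficient at \<open>J\<close> is zero.\<close>
    obtain c where "monomial K \<otimes> monomial J = c \<odot> monomial (mod_add K J)"
      using monomial_mult by blast
    then show ?thesis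
      using dual_monomial[OF J mod_add_exponents, of c K J] mod_add_fixed[OF K J] False by auto
  qed
  have "h b ((\<Oplus>K\<in>?E. u K \<odot> monomial K) \<otimes> y b)
      = (\<Sum>K\<in>?E. \<Sum>J\<in>?E. u K * (Q J b * h b (monomial K \<otimes> monomial J)))" if b: "b \<in> B" for b
  proof -
    have "(\<Oplus>K\<in>?E. u K \<odot> monomial K) \<otimes> y b = (\<Oplus>K\<in>?E. u K \<odot> (monomial K \<otimes> y b))"
      using y[OF b] by (simp add: finsum_ldistr smult_mult_left)
    then have "h b ((\<Oplus>K\<in>?E. u K \<odot> monomial K) \<otimes> y b) = (\<Sum>K\<in>?E. u K * h b (monomial K \<otimes> y b))"
      using b y by (simp add: linear_functional_lincomb[OF h])
    moreover have "monomial K \<otimes> y b = (\<Oplus>J\<in>?E. Q J b \<odot> (monomial K \<otimes> monomial J))" for K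
      by (simp add: Q[OF b] finsum_rdistr smult_mult_right)
    ultimately show ?thesis
      using b by (simp add: linear_functional_lincomb[OF h] sum_distrib_left)
  qed
  then have "(\<Sum>b\<in>B. h b ((\<Oplus>K\<in>?E. u K \<odot> monomial K) \<otimes> y b))
      = (\<Sum>b\<in>B. \<Sum>K\<in>?E. \<Sum>J\<in>?E. u K * (Q J b * h b (monomial K \<otimes> monomial J)))"
    by simp
  also have "\<dots> = (\<Sum>K\<in>?E. \<Sum>J\<in>?E. u K * (\<Sum>b\<in>B. Q J b * h b (monomial K \<otimes> monomial J)))"
    by (subst sum.swap, rule sum.cong[OF refl], subst sum.swap) (simp add: sum_distrib_left)
  also have "\<dots> = (\<Sum>K\<in>?E. \<Sum>J\<in>?E. if ?z = K then u K else 0)"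
    by (intro sum.cong refl) (auto simp: diag)
  \<comment> \<open>The inner sum over \<open>J\<close> is constant and counts the
    \<open>m ^ d\<close> exponents.\<close>
  also have "\<dots> = of_nat (m ^ d) * u ?z"
    using zero_exponents by (simp add: card_exponents flip: sum_distrib_left)
  finally show ?thesis .
qed

end

end

section \<open>The presented algebra\<close>

context unital_algebra
begin

text \<open>The construction of \<open>gc_alg\<close> for an arbitrary algebra and ideal, so that
  the algebra laws can be checked once on representatives.\<close>

definition quotient_algebra :: "'a set \<Rightarrow> ('k, 'a set) module" where
  "quotient_algebra I = ring.extend (A Quot I)
     (module.fields (\<lambda>c X. I <+> ((\<lambda>x. c \<odot> x) ` X)))"

lemma quotient_algebra_simps:
  "carrier (quotient_algebra I) = carrier (A Quot I)"
  "mult (quotient_algebra I) = mult (A Quot I)"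
  "one (quotient_algebra I) = one (A Quot I)"
  "add (quotient_algebra I) = add (A Quot I)"
  "zero (quotient_algebra I) = zero (A Quot I)"
  "smult (quotient_algebra I) c X = I <+> ((\<lambda>x. c \<odot> x) ` X)"
  by (simp_all add: quotient_algebra_def ring.defs module.defs)

context
  fixes I :: "'a set"
  assumes ideal: "ideal I A"
begin

interpretation ideal I A by (rule ideal)

lemma coset_closed: "x \<in> carrier A \<Longrightarrow> I +> x \<in> carrier (quotient_algebra I)"
  by (auto simp: quotient_algebra_simps FactRing_simps)

lemma quotient_algebra_elem:
  assumes "X \<in> carrier (quotient_algebra I)"
  obtains x where "x \<in> carrier A" "X = I +> x"
  using assms by (auto simp: quotient_algebra_simps FactRing_simps)

lemma coset_mult:
  "\<lbrakk>x \<in> carrier A; y \<in> carrier A\<rbrakk>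
    \<Longrightarrow> (I +> x) \<otimes>\<^bsub>quotient_algebra I\<^esub> (I +> y) = I +> (x \<otimes> y)"
  by (simp add: quotient_algebra_simps FactRing_simps rcoset_mult_add)

lemma coset_add:
  "\<lbrakk>x \<in> carrier A; y \<in> carrier A\<rbrakk>
    \<Longrightarrow> (I +> x) \<oplus>\<^bsub>quotient_algebra I\<^esub> (I +> y) = I +> (x \<oplus> y)"
  by (simp add: quotient_algebra_simps FactRing_simps a_rcos_sum)

lemma coset_one: "\<one>\<^bsub>quotient_algebra I\<^esub> = I +> \<one>"
  by (simp add: quotient_algebra_simps FactRing_simps)

lemma coset_zero: "\<zero>\<^bsub>quotient_algebra I\<^esub> = I +> \<zero>"
  using a_coset_add_zero[OF a_subset] by (simp add: quotient_algebra_simps FactRing_simps)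

text \<open>Ideals are defined through ring multiplication alone; scaling by \<open>c\<close> is
  multiplication by the ring element \<open>c \<odot> \<one>\<close>.\<close>

lemma ideal_smult: "x \<in> I \<Longrightarrow> c \<odot> x \<in> I"
  using I_l_closed[of x "c \<odot> \<one>"] a_Hcarr[of x] by (simp add: smult_mult_left)

text \<open>An element i + c (j + x) regroups as (i + c j) + c x with i + c j in \<open>I\<close>;
  taking j = 0 gives the converse inclusion.\<close>

lemma coset_smult:
  assumes x: "x \<in> carrier A"
  shows "c \<odot>\<^bsub>quotient_algebra I\<^esub> (I +> x) = I +> (c \<odot> x)"
proof -
  have "I <+> ((\<lambda>x. c \<odot> x) ` (I +> x)) = {i \<oplus> (c \<odot> (j \<oplus> x)) | i j. i \<in> I \<and> j \<in> I}"
    by (auto simp: set_add_def set_mult_def a_r_coset_def r_coset_def)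
  also have "\<dots> = {i \<oplus> (c \<odot> x) | i. i \<in> I}"
  proof (intro equalityI subsetI)
    fix z assume "z \<in> {i \<oplus> (c \<odot> (j \<oplus> x)) | i j. i \<in> I \<and> j \<in> I}"
    then obtain i j where "i \<in> I" "j \<in> I" "z = i \<oplus> (c \<odot> (j \<oplus> x))" by blast
    then have "z = (i \<oplus> (c \<odot> j)) \<oplus> (c \<odot> x)" "i \<oplus> (c \<odot> j) \<in> I"
      using x by (auto simp: smult_r_distr a_assoc ideal_smult a_Hcarr)
    then show "z \<in> {i \<oplus> (c \<odot> x) | i. i \<in> I}" by blast
  next
    fix z assume "z \<in> {i \<oplus> (c \<odot> x) | i. i \<in> I}"
    then obtain i where "i \<in> I" "z = i \<oplus> (c \<odot> x)" by blast
    then have "z = i \<oplus> (c \<odot> (\<zero> \<oplus> x))" using x by simp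
    then show "z \<in> {i \<oplus> (c \<odot> (j \<oplus> x)) | i j. i \<in> I \<and> j \<in> I}"
      using \<open>i \<in> I\<close> additive_subgroup.zero_closed[OF is_additive_subgroup] by blast
  qed
  also have "\<dots> = I +> (c \<odot> x)"
    by (auto simp: a_r_coset_def r_coset_def)
  finally show ?thesis by (simp add: quotient_algebra_simps)
qed

text \<open>Applied to the relators, this turns membership in the ideal into the defining
  relations.\<close>

lemma coset_eqI:
  assumes "x \<ominus> y \<in> I" "x \<in> carrier A" "y \<in> carrier A"
  shows "I +> x = I +> y"
proof (rule a_coset_add_inv1)
  show "I +> (x \<oplus> \<ominus> y) = I"
    using a_rcos_const[OF assms(1)] by (simp add: a_minus_def)
qed (use assms a_subset in auto)

text \<open>All identities descend from representatives; the existence of additive inverses is taken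
  from the quotient ring.\<close>

lemma unital_algebra_quotient: "unital_algebra (quotient_algebra I)"
proof -
  interpret q: ring "A Quot I" by (rule quotient_is_ring)
  show ?thesis
  proof (intro unital_algebra.intro ringI abelian_groupI monoidI unital_algebra_axioms.intro)
    fix X assume "X \<in> carrier (quotient_algebra I)"
    then show "\<exists>Y\<in>carrier (quotient_algebra I).
        Y \<oplus>\<^bsub>quotient_algebra I\<^esub> X = \<zero>\<^bsub>quotient_algebra I\<^esub>"
      using q.l_neg q.a_inv_closed unfolding quotient_algebra_simps by blast
  qed (auto elim!: quotient_algebra_elem simp: coset_mult coset_add coset_smult coset_closed
        coset_one coset_zero a_ac m_assoc l_distr r_distr
        smult_l_distr smult_r_distr smult_smult smult_mult_left smult_mult_right)
qed

lemma coset_pow: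
  assumes "x \<in> carrier A"
  shows "(I +> x) [^]\<^bsub>quotient_algebra I\<^esub> (n::nat) = I +> (x [^] n)"
proof -
  interpret q: unital_algebra "quotient_algebra I" by (rule unital_algebra_quotient)
  show ?thesis using assms by (induct n) (auto simp: coset_one coset_mult)
qed

end

end

section \<open>The free algebra on words\<close>

lemma free_alg_simps:
  "carrier (free_alg d) = {f. finite {w. f w \<noteq> 0} \<and> (\<forall>w. f w \<noteq> 0 \<longrightarrow> set w \<subseteq> {1..d})}"
  "mult (free_alg d) f g w = (\<Sum>(u, v)\<in>{(u, v). u @ v = w}. f u * g v)"
  "one (free_alg d) = (\<lambda>w. if w = [] then 1 else 0)"
  "zero (free_alg d) = (\<lambda>w. 0)"
  "add (free_alg d) f g = (\<lambda>w. f w + g w)"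
  "smult (free_alg d) c f = (\<lambda>w. c * f w)"
  by (simp_all add: free_alg_def)

text \<open>A splitting is determined by the length of its first part. Finiteness gives the
  convolution sums their intended value, as a sum over an infinite set defaults to 0.\<close>

lemma finite_splits [simp]: "finite {(u, v). u @ v = w}"
proof (rule finite_surj)
  show "{(u, v). u @ v = w} \<subseteq> (\<lambda>i. (take i w, drop i w)) ` {..length w}"
  proof
    fix x assume "x \<in> {(u, v). u @ v = w}"
    then show "x \<in> (\<lambda>i. (take i w, drop i w)) ` {..length w}"
      by (intro image_eqI[of _ _ "length (fst x)"]) auto
  qed
qed simp

text \<open>Both sides are sums over the factorizations of \<open>w\<close> into three words,
  grouped differently.\<close>

lemma free_alg_mult_assoc:
  "(f \<otimes>\<^bsub>free_alg d\<^esub> g) \<otimes>\<^bsub>free_alg d\<^esub> h = f \<otimes>\<^bsub>free_alg d\<^esub> (g \<otimes>\<^bsub>free_alg d\<^esub> h)"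
proof
  fix w
  have "((f \<otimes>\<^bsub>free_alg d\<^esub> g) \<otimes>\<^bsub>free_alg d\<^esub> h) w
      = (\<Sum>x\<in>{(u, v). u @ v = w}. \<Sum>y\<in>{(a, b). a @ b = fst x}. f (fst y) * g (snd y) * h (snd x))"
    by (simp add: free_alg_simps case_prod_unfold sum_distrib_right)
  also have "\<dots> = (\<Sum>(x, y)\<in>Sigma {(u, v). u @ v = w} (\<lambda>x. {(a, b). a @ b = fst x}).
      f (fst y) * g (snd y) * h (snd x))"
    by (rule sum.Sigma) auto
  also have "\<dots> = (\<Sum>(x, y)\<in>Sigma {(u, v). u @ v = w} (\<lambda>x. {(a, b). a @ b = snd x}).
      f (fst x) * (g (fst y) * h (snd y)))"
    \<comment> \<open>The witnesses pass between the groupings \<open>(a @ b) @ v\<close> and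
      \<open>a @ (b @ v)\<close>.\<close>
    by (rule sum.reindex_bij_witness[of _
          "\<lambda>((a, v'), (b, v)). ((a @ b, v), (a, b))" "\<lambda>((u, v), (a, b)). ((a, b @ v), (b, v))"])
      (auto simp: mult.assoc)
  also have "\<dots> = (\<Sum>x\<in>{(u, v). u @ v = w}. \<Sum>y\<in>{(a, b). a @ b = snd x}. f (fst x) * (g (fst y) * h (snd y)))"
    by (rule sum.Sigma[symmetric]) auto
  also have "\<dots> = (f \<otimes>\<^bsub>free_alg d\<^esub> (g \<otimes>\<^bsub>free_alg d\<^esub> h)) w"
    by (simp add: free_alg_simps case_prod_unfold sum_distrib_left)
  finally show "((f \<otimes>\<^bsub>free_alg d\<^esub> g) \<otimes>\<^bsub>free_alg d\<^esub> h) w = (f \<otimes>\<^bsub>free_alg d\<^esub> (g \<otimes>\<^bsub>free_alg d\<^esub> h)) w" .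
qed

definition free_word :: "nat list \<Rightarrow> nat list \<Rightarrow> complex" where
  "free_word w = (\<lambda>v. if v = w then 1 else 0)"

lemma free_gen_eq_word: "free_gen j = free_word [j]"
  by (simp add: free_gen_def free_word_def)

lemma free_alg_one_eq_word: "\<one>\<^bsub>free_alg d\<^esub> = free_word []"
  by (simp add: free_alg_simps free_word_def)

lemma free_word_closed: "set w \<subseteq> {1..d} \<Longrightarrow> free_word w \<in> carrier (free_alg d)"
  by (auto simp: free_alg_simps free_word_def)

text \<open>Only the splitting with first part \<open>u\<close> contributes, and it exists exactly
  when \<open>w\<close> begins with \<open>u\<close>.\<close>

lemma free_word_mult_apply:
  "(free_word u \<otimes>\<^bsub>free_alg d\<^esub> f) w = (if take (length u) w = u then f (drop (length u) w) else 0)"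
proof -
  have "(free_word u \<otimes>\<^bsub>free_alg d\<^esub> f) w
      = (\<Sum>x\<in>{(a, b). a @ b = w}. if (u, drop (length u) w) = x then f (drop (length u) w) else 0)"
    unfolding free_alg_simps by (rule sum.cong) (auto simp: free_word_def split: if_splits)
  also have "\<dots> = (if (u, drop (length u) w) \<in> {(a, b). a @ b = w} then f (drop (length u) w) else 0)"
    by (rule sum.delta'[OF finite_splits])
  moreover have "u @ drop (length u) w = w \<longleftrightarrow> take (length u) w = u"
    by (metis append_eq_conv_conj append_take_drop_id)
  ultimately show ?thesis by simp
qed

lemma mult_free_nil_apply: "(f \<otimes>\<^bsub>free_alg d\<^esub> free_word []) w = f w"
proof -
  have "(f \<otimes>\<^bsub>free_alg d\<^esub> free_word []) w = (\<Sum>x\<in>{(a, b). a @ b = w}. if (w, []) = x then f w else 0)"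
    unfolding free_alg_simps by (rule sum.cong) (auto simp: free_word_def split: if_splits)
  also have "\<dots> = f w"
    by (subst sum.delta'[OF finite_splits]) simp
  finally show ?thesis .
qed

lemma free_word_append: "free_word u \<otimes>\<^bsub>free_alg d\<^esub> free_word v = free_word (u @ v)"
proof
  fix w
  have "w = u @ v \<longleftrightarrow> take (length u) w = u \<and> drop (length u) w = v"
    by (metis append_eq_conv_conj)
  then show "(free_word u \<otimes>\<^bsub>free_alg d\<^esub> free_word v) w = free_word (u @ v) w"
    unfolding free_word_mult_apply by (auto simp: free_word_def)
qed

text \<open>Every word in the support of the product is a concatenation of words from the two
  supports, which bounds both the support and the letters.\<close>

lemma free_alg_mult_closed:
  assumes "f \<in> carrier (free_alg d)" "g \<in> carrier (free_alg d)"
  shows "f \<otimes>\<^bsub>free_alg d\<^esub> g \<in> carrier (free_alg d)"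
proof -
  have *: "\<exists>u v. u @ v = w \<and> f u \<noteq> 0 \<and> g v \<noteq> 0" if "(f \<otimes>\<^bsub>free_alg d\<^esub> g) w \<noteq> 0" for w
  proof (rule ccontr)
    assume "\<not> ?thesis"
    then have "(f \<otimes>\<^bsub>free_alg d\<^esub> g) w = 0"
      unfolding free_alg_simps by (intro sum.neutral) auto
    with that show False by simp
  qed
  have "{w. (f \<otimes>\<^bsub>free_alg d\<^esub> g) w \<noteq> 0} \<subseteq> (\<lambda>(u, v). u @ v) ` ({u. f u \<noteq> 0} \<times> {v. g v \<noteq> 0})"
    using * by fastforce
  then have "finite {w. (f \<otimes>\<^bsub>free_alg d\<^esub> g) w \<noteq> 0}"
    using assms by (auto simp: free_alg_simps(1) intro: finite_subset)
  moreover have "set w \<subseteq> {1..d}" if "(f \<otimes>\<^bsub>free_alg d\<^esub> g) w \<noteq> 0" for w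
    using *[OF that] assms by (fastforce simp: free_alg_simps(1))
  ultimately show ?thesis by (simp add: free_alg_simps(1))
qed

lemma free_alg_add_closed:
  assumes "f \<in> carrier (free_alg d)" "g \<in> carrier (free_alg d)"
  shows "f \<oplus>\<^bsub>free_alg d\<^esub> g \<in> carrier (free_alg d)"
proof -
  have "{w. f w + g w \<noteq> 0} \<subseteq> {w. f w \<noteq> 0} \<union> {w. g w \<noteq> 0}" by auto
  then have "finite {w. f w + g w \<noteq> 0}"
    using assms by (auto simp: free_alg_simps intro: finite_subset)
  moreover have "set w \<subseteq> {1..d}" if "f w + g w \<noteq> 0" for w
    using that assms by (cases "f w = 0") (auto simp: free_alg_simps)
  ultimately show ?thesis by (simp add: free_alg_simps)
qed

lemma free_alg_smult_closed:
  assumes "f \<in> carrier (free_alg d)"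
  shows "c \<odot>\<^bsub>free_alg d\<^esub> f \<in> carrier (free_alg d)"
  using assms by (auto simp: free_alg_simps)

lemma unital_algebra_free_alg: "unital_algebra (free_alg d)"
proof (intro unital_algebra.intro ringI abelian_groupI monoidI unital_algebra_axioms.intro)
  fix f assume f: "f \<in> carrier (free_alg d)"
  have "(-1) \<odot>\<^bsub>free_alg d\<^esub> f \<in> carrier (free_alg d)"
    "((-1) \<odot>\<^bsub>free_alg d\<^esub> f) \<oplus>\<^bsub>free_alg d\<^esub> f = \<zero>\<^bsub>free_alg d\<^esub>"
    using f by (auto simp: free_alg_smult_closed) (simp add: free_alg_simps)
  then show "\<exists>g\<in>carrier (free_alg d). g \<oplus>\<^bsub>free_alg d\<^esub> f = \<zero>\<^bsub>free_alg d\<^esub>" by blast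
qed (auto simp: free_alg_mult_closed free_alg_add_closed free_alg_smult_closed free_alg_mult_assoc
    free_alg_one_eq_word free_word_mult_apply mult_free_nil_apply free_word_closed fun_eq_iff,
    auto simp: free_alg_simps algebra_simps sum.distrib sum_distrib_left case_prod_unfold)

section \<open>Relations and spanning set of the generalized Clifford algebra\<close>

lemma gc_alg_eq_quotient: "gc_alg m d = unital_algebra.quotient_algebra (free_alg d) (gc_ideal m d)"
  by (simp add: gc_alg_def unital_algebra.quotient_algebra_def[OF unital_algebra_free_alg])

lemma omega_nonzero [simp]: "omega m \<noteq> 0"
  by (simp add: omega_def)

lemma gc_relators_closed: "gc_relators m d \<subseteq> carrier (free_alg d)"
proof -
  interpret F: unital_algebra "free_alg d" by (rule unital_algebra_free_alg)
  have "free_gen j \<in> carrier (free_alg d)" if "j \<in> {1..d}" for j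
    using that by (auto simp: free_gen_eq_word intro!: free_word_closed)
  then show ?thesis by (auto simp: gc_relators_def Let_def)
qed

lemma ideal_gc_ideal: "ideal (gc_ideal m d) (free_alg d)"
proof -
  interpret F: unital_algebra "free_alg d" by (rule unital_algebra_free_alg)
  show ?thesis unfolding gc_ideal_def by (rule F.genideal_ideal[OF gc_relators_closed])
qed

lemma gc_relators_subset_ideal: "gc_relators m d \<subseteq> gc_ideal m d"
proof -
  interpret F: unital_algebra "free_alg d" by (rule unital_algebra_free_alg)
  show ?thesis unfolding gc_ideal_def by (rule F.genideal_self[OF gc_relators_closed])
qed

lemma quasi_commuting_roots_gc_alg:
  assumes "m \<ge> 2"
  shows "quasi_commuting_roots (gc_alg m d) m d (gc_gen m d)"
proof -
  interpret F: unital_algebra "free_alg d" by (rule unital_algebra_free_alg)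
  note I = ideal_gc_ideal[of m d]
  note coset = F.coset_mult[OF I] F.coset_smult[OF I] F.coset_pow[OF I] F.coset_one[OF I]
  interpret G: unital_algebra "gc_alg m d"
    unfolding gc_alg_eq_quotient by (rule F.unital_algebra_quotient[OF I])
  have gen: "free_gen j \<in> carrier (free_alg d)" if "j \<in> {1..d}" for j
    using that by (auto simp: free_gen_eq_word intro!: free_word_closed)
  show ?thesis
  proof
    show "m \<ge> 2" by fact
    fix j assume j: "j \<in> {1..d}"
    show "gc_gen m d j \<in> carrier (gc_alg m d)"
      unfolding gc_alg_eq_quotient gc_gen_def by (rule F.coset_closed[OF I gen[OF j]])
    have "free_gen j [^]\<^bsub>free_alg d\<^esub> m \<ominus>\<^bsub>free_alg d\<^esub> \<one>\<^bsub>free_alg d\<^esub> \<in> gc_ideal m d"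
      using j gc_relators_subset_ideal[of m d] by (auto simp: gc_relators_def Let_def)
    from F.coset_eqI[OF I this] show "gc_gen m d j [^]\<^bsub>gc_alg m d\<^esub> m = \<one>\<^bsub>gc_alg m d\<^esub>"
      using gen[OF j] by (simp add: gc_alg_eq_quotient gc_gen_def coset)
  next
    fix k l assume kl: "k \<in> {1..d}" "l \<in> {1..d}" "k < l"
    note [simp] = gen[OF kl(1)] gen[OF kl(2)]
    let ?kl = "free_gen k \<otimes>\<^bsub>free_alg d\<^esub> free_gen l" and ?lk = "free_gen l \<otimes>\<^bsub>free_alg d\<^esub> free_gen k"
    have "?kl \<ominus>\<^bsub>free_alg d\<^esub> (omega m \<odot>\<^bsub>free_alg d\<^esub> ?lk) \<in> gc_ideal m d"
      using kl gc_relators_subset_ideal[of m d] unfolding gc_relators_def Let_def by blast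
    from F.coset_eqI[OF I this]
    have "gc_gen m d k \<otimes>\<^bsub>gc_alg m d\<^esub> gc_gen m d l
        = omega m \<odot>\<^bsub>gc_alg m d\<^esub> (gc_gen m d l \<otimes>\<^bsub>gc_alg m d\<^esub> gc_gen m d k)"
      by (simp add: gc_alg_eq_quotient gc_gen_def coset)
    \<comment> \<open>The relation has the smaller index first on the left, whereas
      \<open>gen_commute\<close> asks for the reverse; dividing by the nonzero
      \<open>omega m\<close> turns it round.\<close>
    then have "inverse (omega m) \<odot>\<^bsub>gc_alg m d\<^esub> (gc_gen m d k \<otimes>\<^bsub>gc_alg m d\<^esub> gc_gen m d l)
        = gc_gen m d l \<otimes>\<^bsub>gc_alg m d\<^esub> gc_gen m d k"
      using F.coset_closed[OF I gen[OF kl(1)]] F.coset_closed[OF I gen[OF kl(2)]]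
      by (simp add: G.smult_smult gc_gen_def flip: gc_alg_eq_quotient)
    then show "G.scalar_commute (gc_gen m d l) (gc_gen m d k)"
      unfolding G.scalar_commute_def by metis
  qed
qed

text \<open>Words are treated by induction on their length, general elements by induction on the
  size of their support.\<close>

lemma gc_alg_spanned_by_monomials:
  assumes "m \<ge> 2"
  shows "carrier (gc_alg m d) \<subseteq> quasi_commuting_roots.monomial_span (gc_alg m d) m d (gc_gen m d)"
proof
  interpret F: unital_algebra "free_alg d" by (rule unital_algebra_free_alg)
  interpret G: quasi_commuting_roots "gc_alg m d" m d "gc_gen m d"
    by (rule quasi_commuting_roots_gc_alg[OF assms])
  note I = ideal_gc_ideal[of m d]
  let ?coset = "\<lambda>f. gc_ideal m d +>\<^bsub>free_alg d\<^esub> f"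
  have word: "?coset (free_word w) \<in> G.monomial_span" if "set w \<subseteq> {1..d}" for w
    using that
  proof (induct w)
    case Nil
    show ?case
      using G.monomial_span_one F.coset_one[OF I]
      by (simp add: gc_alg_eq_quotient free_alg_one_eq_word)
  next
    case (Cons j w)
    have "?coset (free_word (j # w)) = gc_gen m d j \<otimes>\<^bsub>gc_alg m d\<^esub> ?coset (free_word w)"
      using Cons.prems free_word_append[where u = "[j]" and v = w]
      by (simp add: gc_alg_eq_quotient gc_gen_def free_gen_eq_word F.coset_mult[OF I] free_word_closed)
    then show ?case using Cons by (auto intro: G.monomial_span_gen_mult)
  qed
  have "?coset f \<in> G.monomial_span" if "f \<in> carrier (free_alg d)" for f
    using that
  proof (induct "card {w. f w \<noteq> 0}" arbitrary: f)
    case 0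
    then have "f = \<zero>\<^bsub>free_alg d\<^esub>" by (auto simp: free_alg_simps fun_eq_iff)
    then show ?case
      using G.monomial_span_zero F.coset_zero[OF I] by (simp add: gc_alg_eq_quotient)
  next
    case (Suc n)
    then have fin: "finite {w. f w \<noteq> 0}" by (simp add: free_alg_simps)
    obtain w where w: "f w \<noteq> 0" using Suc(2) by (metis (mono_tags, lifting) card_eq_0_iff empty_Collect_eq nat.distinct(1))
    \<comment> \<open>Erasing one word shrinks the support by one; \<open>f\<close> is recovered by
      adding back the multiple \<open>f w\<close> of that word.\<close>
    define f' where "f' = f(w := 0)"
    have supp: "{v. f' v \<noteq> 0} = {v. f v \<noteq> 0} - {w}" by (auto simp: f'_def)
    have f': "f' \<in> carrier (free_alg d)"
    proof -
      have "f v \<noteq> 0" if "f' v \<noteq> 0" for v using that by (auto simp: f'_def split: if_splits)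
      then show ?thesis
        using Suc.prems fin unfolding free_alg_simps mem_Collect_eq supp by blast
    qed
    have "?coset f' \<in> G.monomial_span"
      using Suc(2) fin w f' by (intro Suc(1)) (auto simp: supp)
    moreover have "set w \<subseteq> {1..d}" using Suc.prems w by (auto simp: free_alg_simps)
    moreover have "f = (f w \<odot>\<^bsub>free_alg d\<^esub> free_word w) \<oplus>\<^bsub>free_alg d\<^esub> f'"
      by (auto simp: free_alg_simps free_word_def f'_def fun_eq_iff)
    then have "?coset f = ?coset ((f w \<odot>\<^bsub>free_alg d\<^esub> free_word w) \<oplus>\<^bsub>free_alg d\<^esub> f')" by simp
    ultimately show ?case
      using f' G.monomial_span_add[OF G.monomial_span_smult[OF word]]
      by (simp add: gc_alg_eq_quotient free_word_closed flip: F.coset_add[OF I] F.coset_smult[OF I])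
  qed
  then show "x \<in> G.monomial_span" if "x \<in> carrier (gc_alg m d)" for x
    using that F.quotient_algebra_elem[OF I] unfolding gc_alg_eq_quotient by metis
qed

section \<open>Block-diagonal matrices\<close>

lemma diag_block_mat_carrier:
  "set As \<subseteq> carrier_mat n n \<Longrightarrow> diag_block_mat As \<in> carrier_mat (length As * n) (length As * n)"
  by (induct As) (auto simp: Let_def)

text \<open>Since all blocks have size \<open>n\<close>, division with remainder separates the block
  number from the position inside the block. The induction peels off the first block.\<close>

lemma index_diag_block_mat:
  assumes "set As \<subseteq> carrier_mat n n" "i < length As * n" "j < length As * n"
  shows "diag_block_mat As $$ (i, j) =
    (if i div n = j div n then As ! (i div n) $$ (i mod n, j mod n) else 0)"
  using assms
proof (induct As arbitrary: i j)
  case (Cons A As)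
  have n: "n > 0" using Cons.prems(2) by (cases n) auto
  have A: "A \<in> carrier_mat n n" and B: "diag_block_mat As \<in> carrier_mat (length As * n) (length As * n)"
    using Cons.prems(1) by (auto intro: diag_block_mat_carrier)
  \<comment> \<open>Skipping the first block lowers the block number by one and keeps the position
    inside the block.\<close>
  have IH: "diag_block_mat As $$ (i - n, j - n) =
      (if (i - n) div n = (j - n) div n then As ! ((i - n) div n) $$ ((i - n) mod n, (j - n) mod n) else 0)"
    if "\<not> i < n" "\<not> j < n"
    using Cons that by auto
  show ?case
    using A B Cons.prems(2,3) n IH
    by (cases "i < n"; cases "j < n") (auto simp: Let_def le_div_geq le_mod_geq)
qed simp

text \<open>The full matrix algebra becomes the case of a single block, so that even and odd
  \<open>d\<close> share one argument.\<close>

lemma block_mat_alg_one: "block_mat_alg 1 n = module_mat TYPE(complex) n n"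
proof -
  have "{diag_block_mat As | As :: complex mat list. length As = 1 \<and> set As \<subseteq> carrier_mat n n} = carrier_mat n n"
  proof (intro equalityI subsetI)
    fix A :: "complex mat" assume "A \<in> carrier_mat n n"
    then show "A \<in> {diag_block_mat As | As. length As = 1 \<and> set As \<subseteq> carrier_mat n n}"
      by (auto intro!: exI[of _ "[A]"] simp del: diag_block_mat.simps)
  qed (use diag_block_mat_carrier[of _ n] in fastforce)
  then show ?thesis by (simp add: block_mat_alg_def module_mat_def)
qed

lemma block_mat_alg_simps:
  "mult (block_mat_alg k n) = (*)"
  "add (block_mat_alg k n) = (+)"
  "smult (block_mat_alg k n) = (\<cdot>\<^sub>m)"
  by (simp_all add: block_mat_alg_def module_mat_simps)

lemma block_mat_alg_carrier_mat: "carrier (block_mat_alg k n) \<subseteq> carrier_mat (k * n) (k * n)"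
  using diag_block_mat_carrier by (force simp: block_mat_alg_def)

section \<open>Matrix units and the trace\<close>

definition matrix_unit :: "nat \<Rightarrow> nat \<Rightarrow> nat \<Rightarrow> complex mat" where
  "matrix_unit N i j = mat N N (\<lambda>p. if p = (i, j) then 1 else 0)"

text \<open>These are the entries of a block-diagonal matrix that may be nonzero. They index the
  matrix units of the algebra and serve as \<open>B\<close> in the trace computation.\<close>

definition block_positions :: "nat \<Rightarrow> nat \<Rightarrow> (nat \<times> nat) set" where
  "block_positions k n = (SIGMA i:{..<k * n}. {j. j < k * n \<and> j div n = i div n})"

lemma finite_block_positions: "finite (block_positions k n)"
  by (simp add: block_positions_def)

text \<open>The block of \<open>i\<close> is the interval of length \<open>n\<close> starting at
  \<open>i div n * n\<close>.\<close>

lemma card_block_row: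
  assumes "i < k * n"
  shows "card {j. j < k * n \<and> j div n = i div n} = n"
proof -
  have n: "n > 0" using assms by (cases n) auto
  \<comment> \<open>The range \<open>k * n\<close> is a whole number of blocks, so the block of
    \<open>i\<close> does not run past it.\<close>
  have "i div n < k" using assms by (simp add: less_mult_imp_div_less)
  then have "(i div n + 1) * n \<le> k * n" by (intro mult_le_mono1) simp
  then have le: "i div n * n + n \<le> k * n" by simp
  have "j div n = i div n \<longleftrightarrow> j \<in> {i div n * n..<i div n * n + n}" for j
  proof
    assume "j div n = i div n"
    then have "i div n * n + j mod n = j" by (metis div_mult_mod_eq)
    moreover have "j mod n < n" using n by simp
    ultimately show "j \<in> {i div n * n..<i div n * n + n}"
      by (metis atLeastLessThan_iff le_add1 nat_add_left_cancel_less)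
  next
    assume "j \<in> {i div n * n..<i div n * n + n}"
    then show "j div n = i div n"
      by (intro div_nat_eqI) (simp_all add: mult.commute)
  qed
  then have "{j. j < k * n \<and> j div n = i div n} = {..<k * n} \<inter> {i div n * n..<i div n * n + n}"
    by blast
  also have "\<dots> = {i div n * n..<i div n * n + n}"
    using le by (intro Int_absorb1 subsetI) (meson atLeastLessThan_iff lessThan_iff less_le_trans)
  finally have "{j. j < k * n \<and> j div n = i div n} = {i div n * n..<i div n * n + n}" .
  then show ?thesis by simp
qed

lemma card_block_positions: "card (block_positions k n) = k * n * n"
  by (simp add: block_positions_def card_block_row)

lemma matrix_unit_block_mat_alg:
  assumes "(i, j) \<in> block_positions k n"
  shows "matrix_unit (k * n) i j \<in> carrier (block_mat_alg k n)"
proof -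
  \<comment> \<open>Block \<open>q\<close> is the part of the matrix unit in the \<open>n\<close>
    rows and columns from \<open>q * n\<close> on; only the block containing \<open>i\<close> and
    \<open>j\<close> is nonzero.\<close>
  define As where "As = map (\<lambda>q. mat n n (\<lambda>(a, b).
    if (q * n + a, q * n + b) = (i, j) then 1 else 0 :: complex)) [0..<k]"
  have ij: "i < k * n" "j < k * n" "i div n = j div n"
    using assms by (auto simp: block_positions_def)
  have n: "n > 0" using ij by (cases n) auto
  have As: "length As = k" "set As \<subseteq> carrier_mat n n"
    by (auto simp: As_def)
  have "matrix_unit (k * n) i j = diag_block_mat As"
  proof (rule eq_matI)
    fix a b assume "a < dim_row (diag_block_mat As)" "b < dim_col (diag_block_mat As)"
    then have ab: "a < k * n" "b < k * n"
      using diag_block_mat_carrier[OF As(2)] As(1) by auto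
    then have "a div n < k" "b div n < k" by (auto simp: less_mult_imp_div_less)
    then have nth: "As ! (a div n) $$ (a mod n, b mod n)
        = (if (a div n * n + a mod n, a div n * n + b mod n) = (i, j) then 1 else 0)"
      using n by (simp add: As_def)
    show "matrix_unit (k * n) i j $$ (a, b) = diag_block_mat As $$ (a, b)"
    proof (cases "a div n = b div n")
      case True
      then have "a div n * n + b mod n = b" by simp
      then have "As ! (a div n) $$ (a mod n, b mod n) = (if (a, b) = (i, j) then 1 else 0)"
        using nth by simp
      then show ?thesis
        using ab As True by (simp add: index_diag_block_mat matrix_unit_def)
    next
      \<comment> \<open>Off the diagonal blocks both sides vanish, because \<open>i\<close> and
        \<open>j\<close> lie in the same block.\<close>
      case False
      then show ?thesis
        using ab As ij by (auto simp: index_diag_block_mat matrix_unit_def)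
    qed
  qed (use diag_block_mat_carrier[OF As(2)] As(1) in \<open>auto simp: matrix_unit_def\<close>)
  then show ?thesis using As by (auto simp: block_mat_alg_def)
qed

text \<open>Right multiplication by this matrix unit moves column \<open>i\<close> of
  \<open>X\<close> into column \<open>j\<close>. The entry is the diagonal coefficient at the matrix
  unit of left multiplication by \<open>X\<close>.\<close>

lemma index_mult_matrix_unit:
  assumes "X \<in> carrier_mat N N" "i < N" "j < N"
  shows "(X * matrix_unit N i j) $$ (i, j) = X $$ (i, i)"
proof -
  have "(X * matrix_unit N i j) $$ (i, j) = (\<Sum>l = 0..<N. if l = i then X $$ (i, l) else 0)"
    using assms by (simp add: matrix_unit_def scalar_prod_def mult_delta_right)
  then show ?thesis using assms by simp
qed

text \<open>Each diagonal entry is counted once for every column of its block. This is the factor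
  between the trace of left multiplication and the matrix trace.\<close>

lemma sum_mult_matrix_units:
  assumes "X \<in> carrier_mat (k * n) (k * n)"
  shows "(\<Sum>(i, j)\<in>block_positions k n. (X * matrix_unit (k * n) i j) $$ (i, j)) = of_nat n * trace_mat X"
proof -
  have "(\<Sum>(i, j)\<in>block_positions k n. (X * matrix_unit (k * n) i j) $$ (i, j))
      = (\<Sum>(i, j)\<in>block_positions k n. X $$ (i, i))"
    using assms by (intro sum.cong) (auto simp: block_positions_def index_mult_matrix_unit)
  also have "\<dots> = (\<Sum>i<k * n. \<Sum>j | j < k * n \<and> j div n = i div n. X $$ (i, i))"
    unfolding block_positions_def by (rule sum.Sigma[symmetric]) auto
  also have "\<dots> = (\<Sum>i<k * n. of_nat n * X $$ (i, i))"
    by (intro sum.cong) (auto simp: card_block_row)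
  also have "\<dots> = of_nat n * trace_mat X"
    using assms by (simp add: trace_mat_def sum_distrib_left)
  finally show ?thesis .
qed

lemma gc_mat_alg_eq_block_mat_alg:
  "gc_mat_alg m d = block_mat_alg (if even d then 1 else m) (m ^ (d div 2))"
  by (auto simp: gc_mat_alg_def simp flip: block_mat_alg_one elim!: oddE)

section \<open>The trace formula\<close>

theorem lemma7p1:
  fixes m d :: nat
    and \<gamma> :: "(nat list \<Rightarrow> complex) set \<Rightarrow> complex mat"
  assumes "m \<ge> 2"
    and "d \<ge> 1"
    and "\<gamma> \<in> alg_iso (gc_alg m d) (gc_mat_alg m d)"
  shows "\<forall>U\<in>carrier (gc_alg m d).
    trace_mat (\<gamma> U) = of_nat (m ^ ((d + 1) div 2)) * grade0 m d U"
proof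
  fix U assume U: "U \<in> carrier (gc_alg m d)"
  define k where "k = (if even d then 1 else m)"
  define n where "n = m ^ (d div 2)"
  interpret G: quasi_commuting_roots "gc_alg m d" m d "gc_gen m d"
    by (rule quasi_commuting_roots_gc_alg[OF assms(1)])
  note span = gc_alg_spanned_by_monomials[OF assms(1), of d]
  let ?A = "gc_alg m d" and ?E = "gc_exponents m d" and ?B = "block_positions k n"
  have M: "gc_mat_alg m d = block_mat_alg k n"
    by (simp add: gc_mat_alg_eq_block_mat_alg k_def n_def)
  have \<gamma>_mat: "\<gamma> x \<in> carrier_mat (k * n) (k * n)" if "x \<in> carrier ?A" for x
    using assms(3) that block_mat_alg_carrier_mat[of k n]
    by (auto simp: alg_iso_def ring_iso_def Ring.ring_hom_def M)
  have \<gamma>_mult: "\<gamma> (x \<otimes>\<^bsub>?A\<^esub> y) = \<gamma> x * \<gamma> y"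
    and \<gamma>_add: "\<gamma> (x \<oplus>\<^bsub>?A\<^esub> y) = \<gamma> x + \<gamma> y"
    and \<gamma>_smult: "\<gamma> (c \<odot>\<^bsub>?A\<^esub> x) = c \<cdot>\<^sub>m \<gamma> x"
    if "x \<in> carrier ?A" "y \<in> carrier ?A" for x y c
    using assms(3) that
    by (auto simp: alg_iso_def ring_iso_def Ring.ring_hom_def M block_mat_alg_simps)
  \<comment> \<open>The dual pair for the trace computation: entries of the image under
    \<open>\<gamma>\<close> against preimages of the matrix units.\<close>
  define h where "h = (\<lambda>p x. \<gamma> x $$ p)"
  define y where "y = (\<lambda>(i, j). inv_into (carrier ?A) \<gamma> (matrix_unit (k * n) i j))"
  have y: "y p \<in> carrier ?A" "\<gamma> (y p) = matrix_unit (k * n) (fst p) (snd p)" if "p \<in> ?B" for p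
  proof -
    have "matrix_unit (k * n) (fst p) (snd p) \<in> \<gamma> ` carrier ?A"
      using assms(3) that matrix_unit_block_mat_alg[of "fst p" "snd p" k n]
      by (auto simp: alg_iso_def ring_iso_def bij_betw_def M)
    then show "y p \<in> carrier ?A" "\<gamma> (y p) = matrix_unit (k * n) (fst p) (snd p)"
      by (auto simp: y_def case_prod_unfold inv_into_into f_inv_into_f)
  qed
  have h: "G.linear_functional (h p)" if "p \<in> ?B" for p
    using that carrier_matD[OF \<gamma>_mat] unfolding G.linear_functional_def h_def
    by (auto simp: block_positions_def \<gamma>_add \<gamma>_smult)
  have hy: "h p (y q) = (if p = q then 1 else 0)" if "p \<in> ?B" "q \<in> ?B" for p q
    using that by (auto simp: h_def y matrix_unit_def block_positions_def split: if_splits)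
  \<comment> \<open>The dimension count: with e = \<open>d div 2\<close> the left side is m^(2e) for
    even \<open>d\<close> and m * m^(2e) for odd \<open>d\<close>.\<close>
  have "k * n * n = m ^ d"
    by (auto simp: k_def n_def simp flip: power_add mult_2 elim!: evenE oddE)
  then have card: "card ?B = m ^ d" by (simp add: card_block_positions)
  note basis = span finite_block_positions card h y(1) hy
  obtain u where u: "U = (\<Oplus>\<^bsub>?A\<^esub>J\<in>?E. u J \<odot>\<^bsub>?A\<^esub> G.monomial J)"
    using span U unfolding G.monomial_span_def by blast
  have mono: "gc_monomial m d J = G.monomial J" for J
    by (simp add: gc_monomial_def G.monomial_def G.monomial_on_def)
  \<comment> \<open>The family \<open>u\<close> is arbitrary outside the exponent set, while
    \<open>gc_coeffs\<close> asks for an extensional one, hence the restriction.\<close>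
  have "gc_coeffs m d U = restrict u ?E"
    unfolding gc_coeffs_def mono
  proof (rule the_equality, intro conjI)
    show "U = (\<Oplus>\<^bsub>?A\<^esub>J\<in>?E. restrict u ?E J \<odot>\<^bsub>?A\<^esub> G.monomial J)"
      unfolding u by (rule G.finsum_cong) (auto simp: simp_implies_def)
  next
    fix v assume v: "v \<in> ?E \<rightarrow>\<^sub>E UNIV \<and> U = (\<Oplus>\<^bsub>?A\<^esub>J\<in>?E. v J \<odot>\<^bsub>?A\<^esub> G.monomial J)"
    show "v = restrict u ?E"
    proof (rule extensionalityI)
      fix K assume "K \<in> ?E"
      then show "v K = restrict u ?E K"
        using G.monomial_coefficients_unique[OF basis, of v u K] v u by simp
    qed (use v in \<open>auto simp: PiE_def\<close>)
  qed auto
  then have grade0: "grade0 m d U = u (\<lambda>j\<in>{1..d}. 0)"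
    using G.zero_exponents by (simp add: grade0_def)
  have "of_nat n * trace_mat (\<gamma> U)
      = (\<Sum>(i, j)\<in>?B. (\<gamma> U * matrix_unit (k * n) i j) $$ (i, j))"
    by (rule sum_mult_matrix_units[OF \<gamma>_mat[OF U], symmetric])
  also have "\<dots> = (\<Sum>p\<in>?B. h p (U \<otimes>\<^bsub>?A\<^esub> y p))"
    by (rule sum.cong) (auto simp: h_def \<gamma>_mult[OF U] y)
  also have "\<dots> = of_nat (m ^ d) * grade0 m d U"
    unfolding u grade0[unfolded u] by (rule G.trace_left_mult[OF basis])
  \<comment> \<open>The exponents \<open>d div 2\<close> and \<open>(d + 1) div 2\<close> add up to
    \<open>d\<close>. The common factor \<open>n\<close>, nonzero because m is at least 2, is then
    cancelled.\<close>
  also have "m ^ d = n * m ^ ((d + 1) div 2)"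
    unfolding n_def power_add[symmetric] by (rule arg_cong[of _ _ "(^) m"]) presburger
  finally show "trace_mat (\<gamma> U) = of_nat (m ^ ((d + 1) div 2)) * grade0 m d U"
    using assms(1) by (simp add: n_def)
qed

end
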